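(* Let $\lambda,\mu,\nu$ be partitions and let $a\ge b\ge 0$ be integers. Then $$c(\lambda;\mu,\nu)\le c\bigl(\lambda+(1^a);\,\mu+(1^b),\,\nu+(1^{a-b})\bigr)$$ and $$c(\lambda;\mu,\nu)\le c\bigl(\lambda\cup(a);\,\mu\cup(b),\,\nu\cup(a-b)\bigr).$$
   Context: A partition $\lambda=(\lambda_1,\lambda_2,\ldots)$ is a weakly decreasing finite sequence of non-negative integers (padded by zeros when needed; trailing zeros are irrelevant). It is identified with its diagram, having $\lambda_i$ left-justified boxes in row $i$ (matrix coordinates). $\lambda+(1^n)$ is the partition $(\lambda_1+1,\ldots,\lambda_n+1,\lambda_{n+1},\ldots)$, i.e. a column with $n$ boxes is inserted into the diagram. $\lambda\cup(n)$ is the partition obtained by inserting a part $n$, i.e. $(\lambda_1,\ldots,\lambda_i,n,\lambda_{i+1},\ldots)$ with $\lambda_i\ge n\ge\lambda_{i+1}$. (Inserting $n=0$ changes nothing.) For partitions $\mu\subseteq\lambda$, $\lambda/\mu$ is the difference of the sets of boxes. A semistandard tableau of shape $\lambda/\mu$ is a filling $T$ of the boxes with positive integers with $T(i,j)\le T(i,j+1)$ and $T(i,j)<T(i+1,j)$ whenever defined; its content is $\nu$ if $\nu_i$ is the number of entries equal to $i$. Its reverse row word is read from right to left in each row, rows from top to bottom. A word is a lattice word if for all $i,n\ge1$ the number of $i$'s among its first $n$ terms is at least the number of $(i+1)$'s among them. The Littlewood-Richardson coefficient $c(\lambda;\mu,\nu)$ is the number of semistandard tableaux of shape $\lambda/\mu$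 with content $\nu$ whose reverse row word is a lattice word; it is $0$ if $\mu\not\subseteq\lambda$. *)

theory Defs
  imports Main "HOL-Library.FuncSet"
begin

text \<open>
  Rows and columns are numbered from 0: a partition is the function whose value at \<open>i\<close> is the
  part \<open>\<lambda>\<^sub>i\<^sub>+\<^sub>1\<close>. Representing partitions as eventually zero functions identifies sequences that
  differ in trailing zeros. Tableau entries, by contrast, are positive integers, so the entry
  \<open>Suc i\<close> is counted by the value of the content at \<open>i\<close>.
\<close>

definition is_partition :: "(nat \<Rightarrow> nat) \<Rightarrow> bool" where
  "is_partition p \<longleftrightarrow> antimono p \<and> finite {i. p i \<noteq> 0}"

definition num_parts :: "(nat \<Rightarrow> nat) \<Rightarrow> nat" where
  "num_parts p = card {i. p i \<noteq> 0}"

definition diagram :: "(nat \<Rightarrow> nat) \<Rightarrow> (nat \<times> nat) set" where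
  "diagram p = {(i, j). j < p i}"

definition add_column :: "(nat \<Rightarrow> nat) \<Rightarrow> nat \<Rightarrow> nat \<Rightarrow> nat" where
  "add_column p n = (\<lambda>i. if i < n then p i + 1 else p i)"

text \<open>
  The part \<open>n\<close> is inserted before the first part that is at most \<open>n\<close>; such a part
  exists even for \<open>n = 0\<close>, because of the padding by zeros.
\<close>

definition insert_part :: "(nat \<Rightarrow> nat) \<Rightarrow> nat \<Rightarrow> nat \<Rightarrow> nat" where
  "insert_part p n =
     (let k = (LEAST i. p i \<le> n)
      in (\<lambda>i. if i < k then p i else if i = k then n else p (i - 1)))"

definition skew_shape :: "(nat \<Rightarrow> nat) \<Rightarrow> (nat \<Rightarrow> nat) \<Rightarrow> (nat \<times> nat) set" where
  "skew_shape l m = diagram l - diagram m"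

text \<open>
  The extensional function space fixes the values outside the shape, so that fillings can be
  counted as functions.
\<close>

definition semistandard_tableaux ::
    "(nat \<Rightarrow> nat) \<Rightarrow> (nat \<Rightarrow> nat) \<Rightarrow> (nat \<times> nat \<Rightarrow> nat) set" where
  "semistandard_tableaux l m =
     {T \<in> skew_shape l m \<rightarrow>\<^sub>E {1..}.
        (\<forall>i j. (i, j) \<in> skew_shape l m \<and> (i, Suc j) \<in> skew_shape l m
                 \<longrightarrow> T (i, j) \<le> T (i, Suc j)) \<and>
        (\<forall>i j. (i, j) \<in> skew_shape l m \<and> (Suc i, j) \<in> skew_shape l m
                 \<longrightarrow> T (i, j) < T (Suc i, j))}"

definition has_content ::
    "(nat \<Rightarrow> nat) \<Rightarrow> (nat \<Rightarrow> nat) \<Rightarrow> (nat \<times> nat \<Rightarrow> nat) \<Rightarrow> (nat \<Rightarrow> nat) \<Rightarrow> bool" where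
  "has_content l m T v \<longleftrightarrow> (\<forall>i. card {x \<in> skew_shape l m. T x = Suc i} = v i)"

definition reverse_row_word ::
    "(nat \<Rightarrow> nat) \<Rightarrow> (nat \<Rightarrow> nat) \<Rightarrow> (nat \<times> nat \<Rightarrow> nat) \<Rightarrow> nat list" where
  "reverse_row_word l m T =
     concat (map (\<lambda>i. map (\<lambda>j. T (i, j)) (rev [m i..<l i])) [0..<num_parts l])"

definition lattice_word :: "nat list \<Rightarrow> bool" where
  "lattice_word w \<longleftrightarrow>
     (\<forall>i\<ge>1. \<forall>n\<ge>1. count_list (take n w) i \<ge> count_list (take n w) (i + 1))"

definition LR_tableaux ::
    "(nat \<Rightarrow> nat) \<Rightarrow> (nat \<Rightarrow> nat) \<Rightarrow> (nat \<Rightarrow> nat) \<Rightarrow> (nat \<times> nat \<Rightarrow> nat) set" where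
  "LR_tableaux l m v =
     {T \<in> semistandard_tableaux l m.
        has_content l m T v \<and> lattice_word (reverse_row_word l m T)}"

definition LR_coeff :: "(nat \<Rightarrow> nat) \<Rightarrow> (nat \<Rightarrow> nat) \<Rightarrow> (nat \<Rightarrow> nat) \<Rightarrow> nat" where
  "LR_coeff l m v = (if diagram m \<subseteq> diagram l then card (LR_tableaux l m v) else 0)"

lemma finite_diagram:
  assumes "is_partition p"
  shows "finite (diagram p)"
proof -
  have "diagram p \<subseteq> (SIGMA i:{i. p i \<noteq> 0}. {..<p i})"
    by (auto simp: diagram_def)
  moreover have "finite (SIGMA i:{i. p i \<noteq> 0}. {..<p i})"
    using assms by (auto simp: is_partition_def)
  ultimately show ?thesis
    by (rule finite_subset)
qed

lemma finite_LR_tableaux: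
  assumes "is_partition l" and "is_partition v"
  shows "finite (LR_tableaux l m v)"
proof -
  have fin: "finite (skew_shape l m)"
    using finite_diagram[OF assms(1)] by (simp add: skew_shape_def)
  have "LR_tableaux l m v \<subseteq> skew_shape l m \<rightarrow>\<^sub>E Suc ` {i. v i \<noteq> 0}"
  proof
    fix T assume T: "T \<in> LR_tableaux l m v"
    then have E: "T \<in> skew_shape l m \<rightarrow>\<^sub>E {1..}"
      and c: "\<And>i. card {x \<in> skew_shape l m. T x = Suc i} = v i"
      by (auto simp: LR_tableaux_def semistandard_tableaux_def has_content_def)
    have "T x \<in> Suc ` {i. v i \<noteq> 0}" if x: "x \<in> skew_shape l m" for x
    proof -
      have "T x \<ge> 1" using PiE_mem[OF E x] by simp
      then obtain i where i: "T x = Suc i" by (cases "T x") auto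
      have "finite {x \<in> skew_shape l m. T x = Suc i}" using fin by simp
      moreover have "x \<in> {x \<in> skew_shape l m. T x = Suc i}" using x i by simp
      ultimately have "card {x \<in> skew_shape l m. T x = Suc i} \<noteq> 0"
        using card_0_eq by blast
      then have "v i \<noteq> 0" using c[of i] by argo
      then show ?thesis using i by simp
    qed
    then show "T \<in> skew_shape l m \<rightarrow>\<^sub>E Suc ` {i. v i \<noteq> 0}"
      using E by (auto simp: PiE_def)
  qed
  moreover have "finite (skew_shape l m \<rightarrow>\<^sub>E Suc ` {i. v i \<noteq> 0})"
    using fin assms(2) by (intro finite_PiE) (auto simp: is_partition_def)
  ultimately show ?thesis
    by (rule finite_subset)
qed

lemma is_partition_add_column:
  assumes "is_partition p"
  shows "is_partition (add_column p n)"
proof -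
  have "{i. add_column p n i \<noteq> 0} \<subseteq> {i. p i \<noteq> 0} \<union> {..<n}"
    by (auto simp: add_column_def)
  moreover have "antimono (add_column p n)"
  proof (rule antimonoI)
    fix i j :: nat assume "i \<le> j"
    then have "p j \<le> p i" using assms by (simp add: is_partition_def antimonoD)
    then show "add_column p n j \<le> add_column p n i"
      using \<open>i \<le> j\<close> by (simp add: add_column_def)
  qed
  ultimately show ?thesis
    using assms by (simp add: is_partition_def finite_subset)
qed

lemma is_partition_insert_part:
  assumes "is_partition p"
  shows "is_partition (insert_part p n)"
proof -
  define k where "k = (LEAST i. p i \<le> n)"
  have eq: "insert_part p n = (\<lambda>i. if i < k then p i else if i = k then n else p (i - 1))"
    unfolding insert_part_def k_def Let_def ..
  have "finite {i. p i \<noteq> 0}"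
    using assms by (simp add: is_partition_def)
  from ex_new_if_finite[OF infinite_UNIV_nat this] obtain z where "p z = 0"
    by blast
  then have k: "p k \<le> n"
    unfolding k_def using LeastI[of "\<lambda>i. p i \<le> n" z] by simp
  have lt: "n < p i" if "i < k" for i
    using not_less_Least[of i "\<lambda>i. p i \<le> n"] that by (simp add: k_def)
  have anti: "p j \<le> p i" if "i \<le> j" for i j
    using assms that by (simp add: is_partition_def antimonoD)
  have "insert_part p n (Suc i) \<le> insert_part p n i" for i
  proof (cases "i < k")
    case True
    show ?thesis
    proof (cases "Suc i < k")
      case True
      then show ?thesis using anti[of i "Suc i"] by (simp add: eq)
    next
      case False
      then have "Suc i = k" using \<open>i < k\<close> by simp
      then show ?thesis using lt[OF \<open>i < k\<close>] \<open>i < k\<close> by (simp add: eq)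
    qed
  next
    case False
    then show ?thesis
      using k anti[of "i - 1" i] by (cases "i = k") (simp_all add: eq)
  qed
  then have "antimono (insert_part p n)"
    by (simp add: antimono_iff_le_Suc)
  moreover have "{i. insert_part p n i \<noteq> 0} \<subseteq> {i. p i \<noteq> 0} \<union> {k} \<union> Suc ` {i. p i \<noteq> 0}"
  proof
    fix i assume "i \<in> {i. insert_part p n i \<noteq> 0}"
    then have "p i \<noteq> 0 \<or> i = k \<or> (k < i \<and> p (i - 1) \<noteq> 0)"
      by (simp add: eq split: if_splits)
    then show "i \<in> {i. p i \<noteq> 0} \<union> {k} \<union> Suc ` {i. p i \<noteq> 0}"
      by (cases i) auto
  qed
  ultimately show ?thesis
    using assms by (simp add: is_partition_def finite_subset)
qed

end

theory Submission
  imports Defs Complex_Main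
begin

text \<open>
  Littlewood-Richardson tableaux correspond bijectively to integral hives: concave functions on a
  triangular lattice whose boundary values are the partial sums of the three partitions. For each
  inequality we give an injective map between sets of hives. Inserting columns amounts to adding
  the hive of the triple \<open>(1\<^sup>a)\<close>, \<open>(1\<^sup>b)\<close>, \<open>(1\<^bsup>a-b\<^esup>)\<close>. Inserting rows amounts to
  overlaying the dual honeycomb with a single vertex, that is, to a max-plus convolution of hives;
  this preserves concavity, and the original hive can be recovered by Legendre duality.
\<close>

section \<open>Hives\<close>

text \<open>
  The value \<open>h i j\<close> is the number of boxes in the first \<open>i\<close> rows that belong to \<open>m\<close> or have an
  entry at most \<open>j\<close>. The three rhombus inequalities say that multiplicities of entries in rows are
  nonnegative, that columns are strict, and that the reverse row word is a lattice word. Instead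
  of restricting to \<open>j \<le> i\<close>, we let \<open>h\<close> be eventually constant in \<open>j\<close>.
\<close>

definition hives :: "(nat \<Rightarrow> nat) \<Rightarrow> (nat \<Rightarrow> nat) \<Rightarrow> (nat \<Rightarrow> nat) \<Rightarrow> (nat \<Rightarrow> nat \<Rightarrow> nat) set" where
  "hives l m v = {h.
     (\<forall>j. h 0 j = 0) \<and>
     (\<forall>i. h i 0 = sum m {..<i}) \<and>
     (\<forall>i. \<forall>\<^sub>F j in sequentially. h i j = sum l {..<i}) \<and>
     (\<forall>j. \<forall>\<^sub>F i in sequentially. h i j = sum m {..<i} + sum v {..<j}) \<and>
     (\<forall>i j. h (Suc i) j + h i (Suc j) \<le> h (Suc i) (Suc j) + h i j) \<and>
     (\<forall>i j. h (Suc (Suc i)) (Suc j) + h i j \<le> h (Suc i) (Suc j) + h (Suc i) j) \<and>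
     (\<forall>i j. h (Suc i) (Suc (Suc j)) + h i j \<le> h (Suc i) (Suc j) + h i (Suc j))}"

lemma partition_le: "is_partition p \<Longrightarrow> i \<le> j \<Longrightarrow> p j \<le> p i"
  by (simp add: is_partition_def antimonoD)

text \<open>Since the parts decrease weakly, the support is an initial segment; its cardinality is
  then the first index with part 0.\<close>

lemma nonzero_iff_less_num_parts:
  assumes "is_partition p"
  shows "p i \<noteq> 0 \<longleftrightarrow> i < num_parts p"
proof -
  have "finite {i. p i \<noteq> 0}" using assms by (simp add: is_partition_def)
  from ex_new_if_finite[OF infinite_UNIV_nat this] obtain z where z: "p z = 0" by blast
  define k where "k = (LEAST i. p i = 0)"
  have k: "p k = 0" unfolding k_def using z by (rule LeastI)
  have "p i \<noteq> 0" if "i < k" for i using not_less_Least that unfolding k_def by blast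
  moreover have "p i = 0" if "k \<le> i" for i using partition_le[OF assms that] k by simp
  ultimately have *: "p i \<noteq> 0 \<longleftrightarrow> i < k" for i using not_less by blast
  then have "{i. p i \<noteq> 0} = {..<k}" by auto
  then have "num_parts p = k" by (simp add: num_parts_def)
  with * show ?thesis by blast
qed

lemma diagram_subset_iff: "diagram m \<subseteq> diagram l \<longleftrightarrow> (\<forall>i. m i \<le> l i)"
proof
  assume *: "diagram m \<subseteq> diagram l"
  show "\<forall>i. m i \<le> l i"
  proof (rule allI, rule ccontr)
    fix i assume "\<not> m i \<le> l i"
    then have "(i, l i) \<in> diagram m" by (simp add: diagram_def)
    with * show False by (auto simp: diagram_def)
  qed
next
  assume "\<forall>i. m i \<le> l i"
  then show "diagram m \<subseteq> diagram l" by (auto simp: diagram_def intro: less_le_trans)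
qed

lemma mem_skew_shape: "(i, x) \<in> skew_shape l m \<longleftrightarrow> m i \<le> x \<and> x < l i"
  by (auto simp: skew_shape_def diagram_def)

section \<open>Tableaux and the ends of their rows\<close>

text \<open>\<open>R i j\<close> is the column where the entries of row \<open>i\<close> exceeding
  \<open>j\<close> begin, or the end of the row. As a relation it can be entered from
  \<open>T\<close> or from \<open>R\<close>; the existence of \<open>R\<close> already forces weakly
  increasing rows.\<close>

definition row_ends ::
    "(nat \<Rightarrow> nat) \<Rightarrow> (nat \<Rightarrow> nat) \<Rightarrow> (nat \<times> nat \<Rightarrow> nat) \<Rightarrow> (nat \<Rightarrow> nat \<Rightarrow> nat) \<Rightarrow> bool" where
  "row_ends l m T R \<longleftrightarrow> (\<forall>i j. m i \<le> R i j \<and> R i j \<le> l i) \<and>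
     (\<forall>i x j. (i, x) \<in> skew_shape l m \<longrightarrow> (T (i, x) \<le> j \<longleftrightarrow> x < R i j))"

definition row_end :: "(nat \<Rightarrow> nat) \<Rightarrow> (nat \<Rightarrow> nat) \<Rightarrow> (nat \<times> nat \<Rightarrow> nat) \<Rightarrow> nat \<Rightarrow> nat \<Rightarrow> nat" where
  "row_end l m T i j = m i + card {x \<in> {m i..<l i}. T (i, x) \<le> j}"

definition hive_of :: "(nat \<Rightarrow> nat) \<Rightarrow> (nat \<Rightarrow> nat) \<Rightarrow> (nat \<times> nat \<Rightarrow> nat) \<Rightarrow> nat \<Rightarrow> nat \<Rightarrow> nat" where
  "hive_of l m T i j = (\<Sum>k<i. row_end l m T k j)"

lemma row_endsD:
  assumes "row_ends l m T R"
  shows "m i \<le> R i j" "R i j \<le> l i"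
    "m i \<le> x \<Longrightarrow> x < l i \<Longrightarrow> T (i, x) \<le> j \<longleftrightarrow> x < R i j"
  using assms by (auto simp: row_ends_def mem_skew_shape)

lemma row_ends_unique:
  assumes "row_ends l m T R"
  shows "R = row_end l m T"
proof (intro ext)
  fix i j
  have "{x \<in> {m i..<l i}. T (i, x) \<le> j} = {m i..<R i j}"
    using row_endsD(1)[OF assms, of i j] row_endsD(3)[OF assms, of i]
      less_le_trans[OF _ row_endsD(2)[OF assms, of i j]] by auto
  then show "R i j = row_end l m T i j"
    using row_endsD(1)[OF assms, of i j] by (simp add: row_end_def)
qed

lemma row_ends_row_end:
  assumes "T \<in> semistandard_tableaux l m" and "\<And>i. m i \<le> l i"
  shows "row_ends l m T (row_end l m T)"
proof -
  have row: "T (i, x) \<le> T (i, y)" if "x \<le> y" "m i \<le> x" "y < l i" for i x y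
    using that
  proof (induction y rule: dec_induct)
    case (step n)
    then have "T (i, n) \<le> T (i, Suc n)"
      using assms(1) by (auto simp: semistandard_tableaux_def mem_skew_shape)
    with step show ?case by simp
  qed simp
  have "\<exists>e. m i \<le> e \<and> e \<le> l i \<and> {x \<in> {m i..<l i}. T (i, x) \<le> j} = {m i..<e}" for i j
  proof -
    \<comment> \<open>The first column whose entry exceeds \<open>j\<close>; the implication is
      vacuous at \<open>l i\<close>, so the least value exists and is at most
      \<open>l i\<close>.\<close>
    define e where "e = (LEAST x. m i \<le> x \<and> (x < l i \<longrightarrow> j < T (i, x)))"
    have ex: "m i \<le> l i \<and> (l i < l i \<longrightarrow> j < T (i, l i))" using assms(2) by simp
    have "m i \<le> e \<and> (e < l i \<longrightarrow> j < T (i, e))"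
      unfolding e_def by (rule LeastI) (rule ex)
    then have e: "m i \<le> e" "e < l i \<Longrightarrow> j < T (i, e)" by blast+
    have el: "e \<le> l i" unfolding e_def by (rule Least_le) (rule ex)
    have iff: "x < e \<longleftrightarrow> T (i, x) \<le> j" if "m i \<le> x" "x < l i" for x
    proof
      assume "x < e"
      then have "\<not> (m i \<le> x \<and> (x < l i \<longrightarrow> j < T (i, x)))"
        unfolding e_def by (rule not_less_Least)
      with that show "T (i, x) \<le> j" by linarith
    next
      assume *: "T (i, x) \<le> j"
      show "x < e"
      proof (rule ccontr)
        assume "\<not> x < e"
        then have "e \<le> x" "e < l i" using that(2) by linarith+
        with row[of e x i] e(1) that(2) have "T (i, e) \<le> T (i, x)" by blast
        with e(2)[OF \<open>e < l i\<close>] * show False by linarith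
      qed
    qed
    then have "{x \<in> {m i..<l i}. T (i, x) \<le> j} = {m i..<e}"
    proof (intro set_eqI)
      fix x
      show "x \<in> {x \<in> {m i..<l i}. T (i, x) \<le> j} \<longleftrightarrow> x \<in> {m i..<e}"
        using iff[of x] less_le_trans[OF _ el, of x] by auto
    qed
    then show ?thesis using e(1) el by blast
  qed
  then obtain E where E: "\<And>i j. m i \<le> E i j" "\<And>i j. E i j \<le> l i"
    "\<And>i j. {x \<in> {m i..<l i}. T (i, x) \<le> j} = {m i..<E i j}" by metis
  have "T (i, x) \<le> j \<longleftrightarrow> x < E i j" if "(i, x) \<in> skew_shape l m" for i x j
    using eqset_imp_iff[OF E(3)[of i j], of x] that by (simp add: mem_skew_shape)
  then have "row_ends l m T E"
    using E(1,2) by (simp add: row_ends_def)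
  with row_ends_unique[OF this] show ?thesis by simp
qed

section \<open>Counting letters in concatenated words\<close>

lemma count_list_map_distinct:
  "distinct xs \<Longrightarrow> count_list (map f xs) y = card {x \<in> set xs. f x = y}"
proof (induction xs)
  case (Cons x xs)
  have "{z \<in> set (x # xs). f z = y}
      = (if f x = y then insert x {z \<in> set xs. f z = y} else {z \<in> set xs. f z = y})"
    by auto
  with Cons show ?case by simp
qed simp

lemma count_list_concat_map:
  "count_list (concat (map f [0..<n])) y = (\<Sum>k<n. count_list (f k) y)"
  by (induction n) (auto simp: count_list_append)

text \<open>A prefix stops inside some block or is the whole word; the lattice condition can thus be
  checked on complete rows followed by part of one row.\<close>

lemma take_concat_cases:
  "(\<exists>i<length xss. \<exists>k. take n (concat xss) = concat (take i xss) @ take k (xss ! i)) \<or>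
    take n (concat xss) = concat xss"
proof (induction xss arbitrary: n)
  case (Cons xs xss)
  show ?case
  proof (cases "n \<le> length xs")
    case True
    then show ?thesis by (intro disjI1 exI[of _ 0]) auto
  next
    case False
    from Cons[of "n - length xs"] show ?thesis
    proof (elim disjE exE conjE)
      fix i k assume "i < length xss"
        "take (n - length xs) (concat xss) = concat (take i xss) @ take k (xss ! i)"
      with False show ?thesis
        by (intro disjI1 exI[of _ "Suc i"] conjI exI[of _ k]) auto
    qed (use False in auto)
  qed
qed simp

section \<open>Tableau conditions as inequalities between row ends\<close>

context
  fixes l m :: "nat \<Rightarrow> nat" and T R
  assumes l: "is_partition l" and m: "is_partition m" and ml: "\<And>i. m i \<le> l i"
    and R: "row_ends l m T R"
begin

text \<open>Otherwise the entry in column \<open>R i (Suc j)\<close> would be at most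
  \<open>j\<close> but not at most \<open>Suc j\<close>.\<close>

lemma R_mono: "R i j \<le> R i (Suc j)"
proof (rule ccontr)
  assume *: "\<not> R i j \<le> R i (Suc j)"
  have "m i \<le> R i (Suc j)" "R i (Suc j) < l i"
    using row_endsD(1,2)[OF R, of i] * by (auto intro: less_le_trans simp: not_le)
  note K = row_endsD(3)[OF R this]
  from K[of j] K[of "Suc j"] * show False by auto
qed

lemma level_set: "{x \<in> {m i..<l i}. T (i, x) = Suc j} = {R i j..<R i (Suc j)}"
proof -
  have "T (i, x) = Suc j \<longleftrightarrow> R i j \<le> x \<and> x < R i (Suc j)" if "m i \<le> x" "x < l i" for x
    using row_endsD(3)[OF R that, of j] row_endsD(3)[OF R that, of "Suc j"] by auto
  moreover have "m i \<le> x" if "R i j \<le> x" for x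
    using row_endsD(1)[OF R] that by (rule le_trans)
  moreover have "x < l i" if "x < R i (Suc j)" for x
    using that row_endsD(2)[OF R] by (rule less_le_trans)
  ultimately show ?thesis by auto
qed

lemma count_row:
  "count_list (map (\<lambda>x. T (i, x)) (rev [m i..<l i])) (Suc j) = R i (Suc j) - R i j"
proof -
  have "count_list (map (\<lambda>x. T (i, x)) (rev [m i..<l i])) (Suc j)
      = card {x \<in> {m i..<l i}. T (i, x) = Suc j}"
    by (subst count_list_map_distinct) auto
  then show ?thesis unfolding level_set by simp
qed

text \<open>Weak increase along rows is built into \<open>row_ends\<close>. Positivity means that no
  entry is at most 0. Column strictness means that entries at most \<open>Suc j\<close> lie under
  entries at most \<open>j\<close> or under boxes of \<open>m\<close>.\<close>

lemma semistandard_iff: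
  "T \<in> semistandard_tableaux l m \<longleftrightarrow> T \<in> extensional (skew_shape l m) \<and>
     (\<forall>i. R i 0 = m i) \<and> (\<forall>i j. R (Suc i) (Suc j) \<le> R i j)"
proof -
  have pos: "(\<forall>z \<in> skew_shape l m. 1 \<le> T z) \<longleftrightarrow> (\<forall>i. R i 0 = m i)"
  proof
    assume *: "\<forall>z \<in> skew_shape l m. 1 \<le> T z"
    show "\<forall>i. R i 0 = m i"
    proof (rule allI, rule ccontr)
      fix i assume "R i 0 \<noteq> m i"
      then have "m i < R i 0" using row_endsD(1)[OF R, of i 0] by simp
      moreover from this have "m i < l i" using row_endsD(2)[OF R, of i 0] by simp
      ultimately show False
        using row_endsD(3)[OF R, of i "m i" 0] bspec[OF *, of "(i, m i)"]
        by (auto simp: mem_skew_shape)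
    qed
  next
    assume *: "\<forall>i. R i 0 = m i"
    show "\<forall>z \<in> skew_shape l m. 1 \<le> T z"
    proof
      fix z assume "z \<in> skew_shape l m"
      then obtain i x where "z = (i, x)" "m i \<le> x" "x < l i"
        by (cases z) (auto simp: mem_skew_shape)
      then show "1 \<le> T z" using row_endsD(3)[OF R, of i x 0] * by auto
    qed
  qed
  have row: "T (i, x) \<le> T (i, Suc x)"
    if "(i, x) \<in> skew_shape l m" "(i, Suc x) \<in> skew_shape l m" for i x
    using row_endsD(3)[OF R, of i x "T (i, Suc x)"] row_endsD(3)[OF R, of i "Suc x" "T (i, Suc x)"]
      that by (auto simp: mem_skew_shape)
  have col: "(\<forall>i x. (i, x) \<in> skew_shape l m \<and> (Suc i, x) \<in> skew_shape l m
      \<longrightarrow> T (i, x) < T (Suc i, x)) \<longleftrightarrow> (\<forall>i j. R (Suc i) (Suc j) \<le> R i j)"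
    if pos1: "\<forall>z \<in> skew_shape l m. 1 \<le> T z"
  proof
    assume *: "\<forall>i x. (i, x) \<in> skew_shape l m \<and> (Suc i, x) \<in> skew_shape l m
      \<longrightarrow> T (i, x) < T (Suc i, x)"
    show "\<forall>i j. R (Suc i) (Suc j) \<le> R i j"
    proof (intro allI, rule ccontr)
      fix i j assume lt: "\<not> R (Suc i) (Suc j) \<le> R i j"
      \<comment> \<open>The first column where row \<open>i\<close> exceeds \<open>j\<close>
        violates strictness; both boxes lie in the shape because \<open>l\<close> and
        \<open>m\<close> are partitions.\<close>
      define x where "x = R i j"
      have x: "m i \<le> x" "m (Suc i) \<le> x" "x < l (Suc i)" "x < l i"
        using lt row_endsD(1)[OF R, of i j] row_endsD(2)[OF R, of "Suc i" "Suc j"]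
          partition_le[OF l, of i "Suc i"] partition_le[OF m, of i "Suc i"]
        unfolding x_def by linarith+
      have "T (Suc i, x) \<le> Suc j" "\<not> T (i, x) \<le> j"
        using lt row_endsD(3)[OF R x(2,3)] row_endsD(3)[OF R x(1,4)] by (auto simp: x_def)
      moreover have "T (i, x) < T (Suc i, x)" using * x by (auto simp: mem_skew_shape)
      ultimately show False by linarith
    qed
  next
    assume *: "\<forall>i j. R (Suc i) (Suc j) \<le> R i j"
    show "\<forall>i x. (i, x) \<in> skew_shape l m \<and> (Suc i, x) \<in> skew_shape l m
      \<longrightarrow> T (i, x) < T (Suc i, x)"
    proof (intro allI impI, elim conjE)
      fix i x assume 1: "(i, x) \<in> skew_shape l m" and 2: "(Suc i, x) \<in> skew_shape l m"
      obtain j where j: "T (Suc i, x) = Suc j" using pos1 2 by (cases "T (Suc i, x)") auto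
      have "x < R (Suc i) (Suc j)"
        using row_endsD(3)[OF R, of "Suc i" x "Suc j"] 2 j by (auto simp: mem_skew_shape)
      also have "\<dots> \<le> R i j" using * by blast
      finally have "T (i, x) \<le> j"
        using row_endsD(3)[OF R, of i x j] 1 by (auto simp: mem_skew_shape)
      with j show "T (i, x) < T (Suc i, x)" by simp
    qed
  qed
  show ?thesis
    unfolding semistandard_tableaux_def PiE_iff using pos col row by auto
qed

lemma card_level_set:
  assumes "\<And>i. n \<le> i \<Longrightarrow> l i = 0"
  shows "card {x \<in> skew_shape l m. T x = Suc j} + (\<Sum>i<n. R i j) = (\<Sum>i<n. R i (Suc j))"
proof -
  have n: "i < n" if "x < l i" for i x
    using assms[of i] that by (cases "i < n") auto
  have "{x \<in> skew_shape l m. T x = Suc j} = (SIGMA i:{..<n}. {x \<in> {m i..<l i}. T (i, x) = Suc j})"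
    by (auto simp: mem_skew_shape n)
  also have "card \<dots> = (\<Sum>i<n. R i (Suc j) - R i j)"
    unfolding level_set by simp
  also have "\<dots> = (\<Sum>i<n. R i (Suc j)) - (\<Sum>i<n. R i j)"
    by (rule sum_subtractf_nat) (rule R_mono)
  finally show ?thesis using sum_mono[of "{..<n}" "\<lambda>i. R i j" "\<lambda>i. R i (Suc j)"] R_mono by simp
qed

lemma zero_from:
  obtains n where "n0 \<le> n" "\<And>i. n \<le> i \<Longrightarrow> l i = 0"
proof
  show "n0 \<le> max (num_parts l) n0" by simp
  show "l i = 0" if "max (num_parts l) n0 \<le> i" for i
    using nonzero_iff_less_num_parts[OF l, of i] that by simp
qed

text \<open>Passing from \<open>j\<close> to \<open>Suc j\<close> raises the total of the row ends
  by the number of entries \<open>Suc j\<close>. One direction is induction on \<open>j\<close>, the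
  other compares two consecutive totals.\<close>

lemma has_content_iff:
  assumes "\<forall>i. R i 0 = m i"
  shows "has_content l m T v \<longleftrightarrow>
    (\<forall>j. \<forall>\<^sub>F n in sequentially. (\<Sum>i<n. R i j) = sum m {..<n} + sum v {..<j})"
proof
  assume *: "has_content l m T v"
  obtain n where n: "\<And>i. n \<le> i \<Longrightarrow> l i = 0" using zero_from by metis
  have "(\<Sum>i<k. R i j) = sum m {..<k} + sum v {..<j}" if "n \<le> k" for j k
  proof (induction j)
    case 0
    then show ?case using assms by simp
  next
    case (Suc j)
    have "v j + (\<Sum>i<k. R i j) = (\<Sum>i<k. R i (Suc j))"
      using card_level_set[of k j] n that * by (auto simp: has_content_def)
    with Suc show ?case by simp
  qed
  then show "\<forall>j. \<forall>\<^sub>F n in sequentially. (\<Sum>i<n. R i j) = sum m {..<n} + sum v {..<j}"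
    unfolding eventually_sequentially by blast
next
  assume *: "\<forall>j. \<forall>\<^sub>F n in sequentially. (\<Sum>i<n. R i j) = sum m {..<n} + sum v {..<j}"
  show "has_content l m T v"
    unfolding has_content_def
  proof
    fix j
    have "\<forall>\<^sub>F n in sequentially. (\<Sum>i<n. R i j) = sum m {..<n} + sum v {..<j} \<and>
        (\<Sum>i<n. R i (Suc j)) = sum m {..<n} + sum v {..<Suc j}"
      using * by (intro eventually_conj) blast+
    then obtain n0 where n0: "\<And>n. n0 \<le> n \<Longrightarrow> (\<Sum>i<n. R i j) = sum m {..<n} + sum v {..<j} \<and>
        (\<Sum>i<n. R i (Suc j)) = sum m {..<n} + sum v {..<Suc j}"
      unfolding eventually_sequentially by blast
    obtain n where n: "n0 \<le> n" "\<And>i. n \<le> i \<Longrightarrow> l i = 0" using zero_from by metis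
    show "card {x \<in> skew_shape l m. T x = Suc j} = v j"
      using card_level_set[of n j] n n0[of n] by simp
  qed
qed

text \<open>Rows are read from right to left, so larger entries come first. The critical prefixes
  for \<open>Suc j\<close> and \<open>Suc (Suc j)\<close> end in a row after its entries
  \<open>Suc (Suc j)\<close> and before its entries \<open>Suc j\<close>. With \<open>C i j\<close>
  counting \<open>Suc j\<close> in the first \<open>i\<close> rows, they give
  \<open>C (Suc i) (Suc j) \<le> C i j\<close>.\<close>

lemma lattice_word_iff:
  "lattice_word (reverse_row_word l m T) \<longleftrightarrow>
    (\<forall>i j. (\<Sum>k<Suc i. R k (Suc (Suc j))) + (\<Sum>k<i. R k j)
      \<le> (\<Sum>k<Suc i. R k (Suc j)) + (\<Sum>k<i. R k (Suc j)))"
    (is "_ \<longleftrightarrow> (\<forall>i j. ?P i j)")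
proof -
  define row where "row i = map (\<lambda>x. T (i, x)) (rev [m i..<l i])" for i
  define C where "C i j = (\<Sum>k<i. R k (Suc j) - R k j)" for i j
  have C: "C i j + (\<Sum>k<i. R k j) = (\<Sum>k<i. R k (Suc j))" for i j
  proof -
    have "C i j = (\<Sum>k<i. R k (Suc j)) - (\<Sum>k<i. R k j)"
      unfolding C_def by (rule sum_subtractf_nat) (rule R_mono)
    then show ?thesis
      using sum_mono[of "{..<i}" "\<lambda>k. R k j" "\<lambda>k. R k (Suc j)"] R_mono by simp
  qed
  have P: "?P i j \<longleftrightarrow> C (Suc i) (Suc j) \<le> C i j" for i j
    using C[of i j] C[of "Suc i" "Suc j"] by linarith
  have count: "count_list (concat (map row [0..<i])) (Suc j) = C i j" for i j
    unfolding count_list_concat_map C_def row_def count_row ..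
  have word: "reverse_row_word l m T = concat (map row [0..<n])" if "num_parts l \<le> n" for n
  proof -
    have "row i = []" if "num_parts l \<le> i" for i
      using nonzero_iff_less_num_parts[OF l, of i] that by (auto simp: row_def)
    then have "concat (map row [num_parts l..<n]) = []" by (auto simp: concat_eq_Nil_conv)
    moreover have "[0..<n] = [0..<num_parts l] @ [num_parts l..<n]"
      using upt_add_eq_append[of 0 "num_parts l" "n - num_parts l"] that by simp
    ultimately show ?thesis by (simp add: reverse_row_word_def row_def[abs_def] del: concat_eq_Nil_conv)
  qed
  show ?thesis
  proof
    assume lat: "lattice_word (reverse_row_word l m T)"
    show "\<forall>i j. ?P i j"
    proof (intro allI)
      fix i j
      \<comment> \<open>The maximum keeps row \<open>i\<close> among the blocks even beyond the last
        part of \<open>l\<close>.\<close>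
      let ?n = "max (num_parts l) (Suc i)"
      have "[0..<?n] = [0..<i] @ i # [Suc i..<?n]"
        using upt_add_eq_append[of 0 i "?n - i"] upt_conv_Cons[of i ?n] by simp
      moreover have "row i = map (\<lambda>x. T (i, x)) (rev [R i (Suc j)..<l i])
          @ map (\<lambda>x. T (i, x)) (rev [m i..<R i (Suc j)])"
        using upt_add_eq_append[of "m i" "R i (Suc j)" "l i - R i (Suc j)"]
          row_endsD(1,2)[OF R, of i "Suc j"] by (simp add: row_def)
      ultimately obtain w where w: "reverse_row_word l m T
        = (concat (map row [0..<i]) @ map (\<lambda>x. T (i, x)) (rev [R i (Suc j)..<l i])) @ w"
        using word[of ?n] by simp
      \<comment> \<open>The critical prefix: in row \<open>i\<close> it reads exactly the entries
        above \<open>Suc j\<close>.\<close>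
      let ?u = "concat (map row [0..<i]) @ map (\<lambda>x. T (i, x)) (rev [R i (Suc j)..<l i])"
      have "take (length ?u) (reverse_row_word l m T) = ?u" unfolding w by simp
      then have "count_list ?u (Suc (Suc j)) \<le> count_list ?u (Suc j)"
        using lat[unfolded lattice_word_def, rule_format, of "Suc j" "length ?u"]
        by (cases "?u = []") (auto simp: Suc_le_eq)
      moreover have "count_list (map (\<lambda>x. T (i, x)) (rev [R i (Suc j)..<l i])) (Suc (Suc j))
          = R i (Suc (Suc j)) - R i (Suc j)"
      proof -
        have "{x \<in> {R i (Suc j)..<l i}. T (i, x) = Suc (Suc j)}
          = {x \<in> {m i..<l i}. T (i, x) = Suc (Suc j)} \<inter> {R i (Suc j)..}"
          using le_trans[OF row_endsD(1)[OF R, of i "Suc j"]] by auto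
        also have "\<dots> = {R i (Suc j)..<R i (Suc (Suc j))}"
          unfolding level_set by auto
        finally show ?thesis by (subst count_list_map_distinct) auto
      qed
      moreover have "count_list (map (\<lambda>x. T (i, x)) (rev [R i (Suc j)..<l i])) (Suc j) = 0"
      proof -
        have "{x \<in> {R i (Suc j)..<l i}. T (i, x) = Suc j}
          = {x \<in> {m i..<l i}. T (i, x) = Suc j} \<inter> {R i (Suc j)..}"
          using le_trans[OF row_endsD(1)[OF R, of i "Suc j"]] by auto
        also have "\<dots> = {}"
          unfolding level_set by auto
        finally show ?thesis by (subst count_list_map_distinct) auto
      qed
      ultimately show "?P i j"
        unfolding P by (simp add: count_list_append count C_def)
    qed
  next
    assume *: "\<forall>i j. ?P i j"
    have CC: "C i (Suc j) \<le> C i j" for i j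
    proof -
      have "C i (Suc j) \<le> C (Suc i) (Suc j)" by (simp add: C_def)
      with * P show ?thesis using le_trans by blast
    qed
    show "lattice_word (reverse_row_word l m T)"
      unfolding lattice_word_def
    proof (intro allI impI)
      fix y n :: nat assume "1 \<le> y"
      then obtain j where y: "y = Suc j" by (cases y) auto
      from take_concat_cases[of "map row [0..<num_parts l]" n]
      show "count_list (take n (reverse_row_word l m T)) (y + 1)
        \<le> count_list (take n (reverse_row_word l m T)) y"
      proof (elim disjE exE conjE)
        fix i k assume i: "i < length (map row [0..<num_parts l])"
          and t: "take n (concat (map row [0..<num_parts l]))
            = concat (take i (map row [0..<num_parts l])) @ take k (map row [0..<num_parts l] ! i)"
        have t: "take n (reverse_row_word l m T) = concat (map row [0..<i]) @ take k (row i)"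
          using i t word[of "num_parts l"] by (simp add: take_map)
        \<comment> \<open>Worst case: the larger letter is counted in all of row \<open>i\<close>,
          the smaller one only in the rows before it.\<close>
        have "count_list (take k (row i)) z \<le> count_list (row i) z" for z
          using count_list_append[of "take k (row i)" "drop k (row i)" z] by simp
        from this[of "Suc (Suc j)"]
        have "count_list (take k (row i)) (Suc (Suc j)) \<le> R i (Suc (Suc j)) - R i (Suc j)"
          unfolding row_def count_row .
        moreover have "C (Suc i) (Suc j) \<le> C i j" using * P by blast
        ultimately show ?thesis
          unfolding t y by (simp add: count_list_append count C_def)
      next
        assume "take n (concat (map row [0..<num_parts l])) = concat (map row [0..<num_parts l])"
        then show ?thesis using word[of "num_parts l"] CC by (simp add: y count)
      qed
    qed
  qed
qed

lemma row_sum_eventually: "\<forall>\<^sub>F j in sequentially. (\<Sum>k<i. R k j) = sum l {..<i}"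
proof -
  have "\<forall>\<^sub>F j in sequentially. R k j = l k" for k
  proof -
    \<comment> \<open>\<open>Max\<close> is unspecified for an empty row, which is harmless: it is
      used only once column \<open>R k j\<close> is known to lie in the row.\<close>
    have "R k j = l k" if j: "Max (T ` ({k} \<times> {m k..<l k})) \<le> j" for j
    proof (rule ccontr)
      assume "R k j \<noteq> l k"
      then have lt: "R k j < l k" using row_endsD(2)[OF R, of k j] by simp
      then have "T (k, R k j) \<le> Max (T ` ({k} \<times> {m k..<l k}))"
        using row_endsD(1)[OF R, of k j] by (intro Max_ge) auto
      with j row_endsD(3)[OF R row_endsD(1)[OF R] lt, of j] show False by simp
    qed
    then show ?thesis unfolding eventually_sequentially by blast
  qed
  then have "\<forall>\<^sub>F j in sequentially. \<forall>k\<in>{..<i}. R k j = l k"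
    by (intro eventually_ball_finite) auto
  then show ?thesis by eventually_elim simp
qed

text \<open>For the partial sums of \<open>R\<close>, column 0 encodes positivity, the limit in
  \<open>j\<close> is automatic, and the limit in \<open>i\<close> encodes the content. The first
  rhombus is \<open>R_mono\<close>; the other two match \<open>semistandard_iff\<close> and
  \<open>lattice_word_iff\<close>.\<close>

lemma LR_tableaux_iff_hives:
  "T \<in> LR_tableaux l m v \<longleftrightarrow> T \<in> extensional (skew_shape l m) \<and> (\<lambda>i j. \<Sum>k<i. R k j) \<in> hives l m v"
proof -
  have "(\<forall>i. R i 0 = m i) \<longleftrightarrow> (\<forall>i. (\<Sum>k<i. R k 0) = sum m {..<i})"
  proof
    assume *: "\<forall>i. (\<Sum>k<i. R k 0) = sum m {..<i}"
    have "R i 0 = m i" for i using spec[OF *, of i] spec[OF *, of "Suc i"] by simp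
    then show "\<forall>i. R i 0 = m i" by blast
  qed simp
  then show ?thesis
    unfolding LR_tableaux_def mem_Collect_eq semistandard_iff hives_def
    using has_content_iff[of v] lattice_word_iff row_sum_eventually R_mono by auto
qed

end

section \<open>From hives back to tableaux\<close>

lemma hive_monoD:
  assumes "h \<in> hives l m v" and "\<And>i. m i \<le> l i"
  shows "h i j + m i \<le> h (Suc i) j" "h (Suc i) j \<le> h i j + l i"
    "h (Suc i) j + h i (Suc j) \<le> h (Suc i) (Suc j) + h i j"
proof -
  show mono: "h (Suc i) j + h i (Suc j) \<le> h (Suc i) (Suc j) + h i j" for i j
    using assms(1) by (simp add: hives_def)
  \<comment> \<open>The first rhombus makes the increment from row \<open>i\<close> to row
    \<open>Suc i\<close> grow weakly with \<open>j\<close>; it starts at \<open>m i\<close> and ends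
    at \<open>l i\<close>.\<close>
  have mono': "h (Suc i) j + h i j' \<le> h (Suc i) j' + h i j" if "j \<le> j'" for j j'
    using that
  proof (induction rule: dec_induct)
    case (step n)
    with mono[of i n] show ?case by linarith
  qed simp
  show "h i j + m i \<le> h (Suc i) j"
    using mono'[of 0 j] assms(1) by (simp add: hives_def)
  have "\<forall>\<^sub>F j in sequentially. h i j = sum l {..<i}" "\<forall>\<^sub>F j in sequentially. h (Suc i) j = sum l {..<Suc i}"
    using assms(1) unfolding hives_def by blast+
  then have "\<forall>\<^sub>F j' in sequentially. h i j' = sum l {..<i} \<and> h (Suc i) j' = sum l {..<Suc i} \<and> j \<le> j'"
    by (intro eventually_conj eventually_ge_at_top)
  then obtain j' where "h i j' = sum l {..<i}" "h (Suc i) j' = sum l {..<Suc i}" "j \<le> j'"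
    using eventually_happens'[OF sequentially_bot] by blast
  with mono'[of j j'] show "h (Suc i) j \<le> h i j + l i" by simp
qed

text \<open>The increments of \<open>h\<close> serve as row ends. The entry in column
  \<open>x\<close> is the least \<open>j\<close> whose row end lies beyond \<open>x\<close>; it
  exists because the increments reach \<open>l i\<close>.\<close>

lemma row_ends_ex:
  assumes "h \<in> hives l m v" and "\<And>i. m i \<le> l i"
  shows "\<exists>T \<in> extensional (skew_shape l m). row_ends l m T (\<lambda>i j. h (Suc i) j - h i j)"
proof -
  define R where "R i j = h (Suc i) j - h i j" for i j
  define T where "T = restrict (\<lambda>(i, x). LEAST j. x < R i j) (skew_shape l m)"
  have R: "m i \<le> R i j" "R i j \<le> l i" "R i j \<le> R i (Suc j)" for i j
    using hive_monoD[OF assms, of i j] hive_monoD(1)[OF assms, of i "Suc j"]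
    unfolding R_def by linarith+
  have mono: "R i j \<le> R i j'" if "j \<le> j'" for i j j'
    using lift_Suc_mono_le[of "R i"] R(3) that by blast
  have "T (i, x) \<le> j \<longleftrightarrow> x < R i j" if "(i, x) \<in> skew_shape l m" for i x j
  proof -
    have T: "T (i, x) = (LEAST j. x < R i j)" using that by (simp add: T_def)
    have "\<forall>\<^sub>F j in sequentially. h i j = sum l {..<i}" "\<forall>\<^sub>F j in sequentially. h (Suc i) j = sum l {..<Suc i}"
      using assms(1) unfolding hives_def by blast+
    then have "\<forall>\<^sub>F j in sequentially. h i j = sum l {..<i} \<and> h (Suc i) j = sum l {..<Suc i}"
      by (intro eventually_conj)
    then obtain j' where "h i j' = sum l {..<i}" "h (Suc i) j' = sum l {..<Suc i}"
      using eventually_happens'[OF sequentially_bot] by blast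
    then have "x < R i j'" using that by (simp add: R_def mem_skew_shape)
    then have "x < R i (T (i, x))" unfolding T by (rule LeastI)
    then show ?thesis using mono[of "T (i, x)" j i] Least_le[of "\<lambda>j. x < R i j" j] T by auto
  qed
  then have "row_ends l m T R" using R by (simp add: row_ends_def)
  moreover have "T \<in> extensional (skew_shape l m)" by (simp add: T_def)
  ultimately show ?thesis unfolding R_def by blast
qed

lemma hive_of_eq_iff:
  assumes "row_ends l m T R" "row_ends l m T' R'"
    and "T \<in> extensional (skew_shape l m)" "T' \<in> extensional (skew_shape l m)"
    and "hive_of l m T = hive_of l m T'"
  shows "T = T'"
proof (rule extensionalityI[OF assms(3,4)])
  fix z assume z: "z \<in> skew_shape l m"
  have "R i j = R' i j" for i j
    using fun_cong[OF fun_cong[OF assms(5)], of i j] fun_cong[OF fun_cong[OF assms(5)], of "Suc i" j]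
    unfolding row_ends_unique[OF assms(1)] row_ends_unique[OF assms(2)] by (simp add: hive_of_def)
  then have "T z \<le> j \<longleftrightarrow> T' z \<le> j" for j
    using assms(1,2) z by (cases z) (simp add: row_ends_def)
  then show "T z = T' z" by (meson le_antisym order_refl)
qed

lemma bij_betw_hive_of:
  assumes "is_partition l" "is_partition m" "\<And>i. m i \<le> l i"
  shows "bij_betw (hive_of l m) (LR_tableaux l m v) (hives l m v)"
  unfolding bij_betw_def
proof (intro conjI equalityI subsetI)
  have ends: "row_ends l m T (row_end l m T) \<and> T \<in> extensional (skew_shape l m)"
    if "T \<in> LR_tableaux l m v" for T
    using that row_ends_row_end[of T l m] assms(3)
    by (auto simp: LR_tableaux_def semistandard_tableaux_def PiE_def)
  show "inj_on (hive_of l m) (LR_tableaux l m v)"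
    using ends hive_of_eq_iff by (metis (no_types, lifting) inj_onI)
  fix h assume "h \<in> hive_of l m ` LR_tableaux l m v"
  then obtain T where "T \<in> LR_tableaux l m v" "h = hive_of l m T" by blast
  with ends[of T] LR_tableaux_iff_hives[OF assms, of T "row_end l m T" v] show "h \<in> hives l m v"
    by (simp add: hive_of_def[abs_def])
next
  fix h assume h: "h \<in> hives l m v"
  obtain T where T: "T \<in> extensional (skew_shape l m)" "row_ends l m T (\<lambda>i j. h (Suc i) j - h i j)"
    using row_ends_ex[OF h assms(3)] by blast
  have h0: "h 0 j = 0" for j using h by (simp add: hives_def)
  \<comment> \<open>Telescoping; the subtractions are exact because \<open>h\<close> increases
    weakly in \<open>i\<close>.\<close>
  have eq: "(\<Sum>k<i. h (Suc k) j - h k j) = h i j" for i j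
  proof (induction i)
    case (Suc i)
    then show ?case using hive_monoD(1)[OF h assms(3), of i j] by simp
  qed (simp add: h0)
  have "T \<in> LR_tableaux l m v"
    using LR_tableaux_iff_hives[OF assms T(2)] T(1) h by (simp add: eq)
  moreover have "hive_of l m T = h"
    unfolding hive_of_def[abs_def] row_ends_unique[OF T(2), symmetric] eq ..
  ultimately show "h \<in> hive_of l m ` LR_tableaux l m v" by blast
qed

text \<open>Reduces an inequality of coefficients to an injection of hive sets; the finiteness
  required of the target is inherited from tableaux.\<close>

lemma LR_coeff_mono:
  assumes "is_partition l" "is_partition m" "\<And>i. m i \<le> l i"
    and "is_partition l'" "is_partition m'" "is_partition v'" "\<And>i. m' i \<le> l' i"
    and "inj_on f (hives l m v)" "f ` hives l m v \<subseteq> hives l' m' v'"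
  shows "LR_coeff l m v \<le> LR_coeff l' m' v'"
proof -
  note bij = bij_betw_hive_of[OF assms(1-3)] bij_betw_hive_of[OF assms(4,5,7)]
  have "finite (hives l' m' v')"
    using bij_betw_finite[OF bij(2)] finite_LR_tableaux[OF assms(4,6)] by blast
  then have "card (hives l m v) \<le> card (hives l' m' v')"
    using assms(8,9) by (metis card_inj_on_le)
  then show ?thesis
    using assms(3,7) bij_betw_same_card[OF bij(1)] bij_betw_same_card[OF bij(2)]
    by (simp add: LR_coeff_def diagram_subset_iff)
qed

section \<open>Inserting a column\<close>

lemma sum_add_column: "sum (add_column p n) {..<i} = sum p {..<i} + min i n"
  by (induction i) (auto simp: add_column_def)

text \<open>
  The hive of \<open>(1\<^sup>a)\<close>, \<open>(1\<^sup>b)\<close>, \<open>(1\<^bsup>a-b\<^esup>)\<close> is \<open>min i (min a (b + j))\<close>.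
\<close>

lemma add_column_hive:
  assumes h: "h \<in> hives l m v" and "b \<le> a"
  shows "(\<lambda>i j. h i j + min i (min a (b + j)))
    \<in> hives (add_column l a) (add_column m b) (add_column v (a - b))" (is "?H \<in> _")
proof -
  have base: "h 0 j = 0" "h i 0 = sum m {..<i}" for i j
    using h by (simp_all add: hives_def)
  have "\<forall>\<^sub>F j in sequentially. h i j = sum l {..<i}" for i
    using h by (simp add: hives_def)
  then have right: "\<forall>\<^sub>F j in sequentially. ?H i j = sum (add_column l a) {..<i}" for i
  proof (rule eventually_elim2)
    show "\<forall>\<^sub>F j in sequentially. a \<le> j" by (rule eventually_ge_at_top)
  qed (simp add: sum_add_column)
  have "\<forall>\<^sub>F i in sequentially. h i j = sum m {..<i} + sum v {..<j}" for j
    using h by (simp add: hives_def)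
  \<comment> \<open>For \<open>i\<close> at least \<open>a\<close> the added term is
    \<open>min a (b + j)\<close>, which equals \<open>b + min j (a - b)\<close> because
    \<open>b \<le> a\<close>.\<close>
  then have below: "\<forall>\<^sub>F i in sequentially.
      ?H i j = sum (add_column m b) {..<i} + sum (add_column v (a - b)) {..<j}" for j
  proof (rule eventually_elim2)
    show "\<forall>\<^sub>F i in sequentially. a \<le> i" by (rule eventually_ge_at_top)
  qed (use assms(2) in \<open>auto simp: sum_add_column min_def\<close>)
  have rhombi: "h (Suc i) j + h i (Suc j) \<le> h (Suc i) (Suc j) + h i j"
    "h (Suc (Suc i)) (Suc j) + h i j \<le> h (Suc i) (Suc j) + h (Suc i) j"
    "h (Suc i) (Suc (Suc j)) + h i j \<le> h (Suc i) (Suc j) + h i (Suc j)" for i j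
    using h by (simp_all add: hives_def)
  have "?H (Suc i) j + ?H i (Suc j) \<le> ?H (Suc i) (Suc j) + ?H i j" for i j
    using rhombi(1)[of i j] by (simp add: min_def)
  moreover have "?H (Suc (Suc i)) (Suc j) + ?H i j \<le> ?H (Suc i) (Suc j) + ?H (Suc i) j" for i j
    using rhombi(2)[of i j] by (simp add: min_def)
  moreover have "?H (Suc i) (Suc (Suc j)) + ?H i j \<le> ?H (Suc i) (Suc j) + ?H i (Suc j)" for i j
    using rhombi(3)[of i j] by (simp add: min_def)
  ultimately show ?thesis
    using base right below assms(2) unfolding hives_def by (simp add: sum_add_column)
qed

section \<open>Inserting a row\<close>

text \<open>With \<open>p (i - 1)\<close> read as infinite at \<open>i = 0\<close>, the new part is
  the median of \<open>p i\<close>, \<open>n\<close> and \<open>p (i - 1)\<close>; this replaces the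
  search for a position.\<close>

lemma insert_part_eq:
  assumes "is_partition p"
  shows "insert_part p n i = (case i of 0 \<Rightarrow> max (p 0) n | Suc k \<Rightarrow> max (p i) (min n (p k)))"
proof -
  define k where "k = (LEAST i. p i \<le> n)"
  have "p (num_parts p) \<le> n" using nonzero_iff_less_num_parts[OF assms, of "num_parts p"] by simp
  then have "p k \<le> n" unfolding k_def by (rule LeastI)
  then have ge: "p i \<le> n" if "k \<le> i" for i using partition_le[OF assms that] by simp
  have lt: "n < p i" if "i < k" for i using not_less_Least[OF that[unfolded k_def]] by simp
  have "insert_part p n i = (if i < k then p i else if i = k then n else p (i - 1))"
    by (simp add: insert_part_def k_def Let_def)
  then show ?thesis
    using ge[of i] lt[of i] ge[of "i - 1"] lt[of "i - 1"] partition_le[OF assms, of "i - 1" i]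
    by (cases i) auto
qed

text \<open>The first \<open>Suc i\<close> parts have the largest sum among all choices of
  \<open>Suc i\<close> parts: \<open>n\<close> is left out, or it joins the \<open>i\<close> largest
  parts of \<open>p\<close>.\<close>

lemma sum_insert_part:
  assumes "is_partition p"
  shows "sum (insert_part p n) {..<Suc i} = max (sum p {..<Suc i}) (sum p {..<i} + n)"
proof (induction i)
  case 0
  then show ?case by (simp add: insert_part_eq[OF assms])
next
  case (Suc i)
  have "sum (insert_part p n) {..<Suc (Suc i)}
      = sum (insert_part p n) {..<Suc i} + max (p (Suc i)) (min n (p i))"
    by (simp add: insert_part_eq[OF assms])
  then show ?case
    unfolding Suc using partition_le[OF assms, of i "Suc i"] by (auto simp: max_def min_def)
qed

lemma insert_part_mono:
  assumes "is_partition m" "is_partition l" "\<And>i. m i \<le> l i" "b \<le> a"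
  shows "insert_part m b i \<le> insert_part l a i"
  using assms(3)[of i] assms(3)[of "i - 1"] assms(4)
  by (cases i) (auto simp: insert_part_eq[OF assms(1)] insert_part_eq[OF assms(2)])

text \<open>
  The max-plus convolution of \<open>h\<close> with the hive of the partitions \<open>(a)\<close>, \<open>(b)\<close>, \<open>(a - b)\<close>.
\<close>

definition conv :: "nat \<Rightarrow> nat \<Rightarrow> (nat \<Rightarrow> nat \<Rightarrow> nat) \<Rightarrow> nat \<Rightarrow> nat \<Rightarrow> nat" where
  "conv a b h i j = (case i of 0 \<Rightarrow> 0 | Suc i' \<Rightarrow>
     max (max (h i j) (h i' j + b)) (case j of 0 \<Rightarrow> 0 | Suc j' \<Rightarrow> h i' j' + a))"

text \<open>In column 0 the third term is missing; its default 0 is absorbed by the maximum of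
  natural numbers.\<close>

lemma conv_simps:
  "conv a b h 0 j = 0"
  "conv a b h (Suc i) 0 = max (h (Suc i) 0) (h i 0 + b)"
  "conv a b h (Suc i) (Suc j) = max (max (h (Suc i) (Suc j)) (h i (Suc j) + b)) (h i j + a)"
  by (simp_all add: conv_def)

text \<open>For the larger side of a rhombus inequality any term gives a lower bound; the case rules
  that follow say which term attains a value on the smaller side.\<close>

lemma conv_ge:
  "h (Suc i) j \<le> conv a b h (Suc i) j"
  "h i j + b \<le> conv a b h (Suc i) j"
  "h i j + a \<le> conv a b h (Suc i) (Suc j)"
  by (simp_all add: conv_def)

lemma conv_0_cases:
  obtains "conv a b h (Suc i) 0 = h (Suc i) 0" | "conv a b h (Suc i) 0 = h i 0 + b"
  unfolding conv_simps max_def by metis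

lemma conv_Suc_cases:
  obtains "conv a b h (Suc i) (Suc j) = h (Suc i) (Suc j)"
  | "conv a b h (Suc i) (Suc j) = h i (Suc j) + b"
  | "conv a b h (Suc i) (Suc j) = h i j + a"
  unfolding conv_simps max_def by metis

section \<open>Rhombus inequalities for the convolution\<close>

context
  fixes h :: "nat \<Rightarrow> nat \<Rightarrow> nat" and a b :: nat
  assumes h0: "\<And>j. h 0 j = 0"
    and m: "\<And>i. h (Suc (Suc i)) 0 + h i 0 \<le> h (Suc i) 0 + h (Suc i) 0"
    and r1: "\<And>i j. h (Suc i) j + h i (Suc j) \<le> h (Suc i) (Suc j) + h i j"
    and r2: "\<And>i j. h (Suc (Suc i)) (Suc j) + h i j \<le> h (Suc i) (Suc j) + h (Suc i) j"
    and r3: "\<And>i j. h (Suc i) (Suc (Suc j)) + h i j \<le> h (Suc i) (Suc j) + h i (Suc j)"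
    and ab: "b \<le> a"
begin

text \<open>Once the terms attaining the left-hand values are fixed, the claim is linear in nearby
  rhombi of \<open>h\<close>, the bounds \<open>conv_ge\<close> and \<open>b \<le> a\<close>. The
  borders \<open>i = 0\<close> and \<open>j = 0\<close> are separate since terms are missing
  there.\<close>

lemma conv_rhombus1:
  shows "conv a b h (Suc i) j + conv a b h i (Suc j) \<le> conv a b h (Suc i) (Suc j) + conv a b h i j"
proof (cases i; cases j)
  fix i' j' assume ij: "i = Suc i'" "j = Suc j'"
  note facts = r1[of "Suc i'" "Suc j'"] r1[of i' "Suc j'"] r1[of i' j'] r1[of "Suc i'" j']
    r2[of i' "Suc j'"] r2[of i' j'] r3[of "Suc i'" j'] r3[of i' j']
    conv_ge(1)[of h "Suc i'" "Suc (Suc j')" a b] conv_ge(2)[of h "Suc i'" "Suc (Suc j')" b a]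
    conv_ge(3)[of h "Suc i'" "Suc j'" a b] conv_ge(1)[of h i' "Suc j'" a b]
    conv_ge(2)[of h i' "Suc j'" b a] conv_ge(3)[of h i' j' a b] ab
  show ?thesis
    unfolding ij
    by (cases rule: conv_Suc_cases[of a b h "Suc i'" j'];
        cases rule: conv_Suc_cases[of a b h i' "Suc j'"];
        use facts in linarith)
next
  fix i' assume ij: "i = Suc i'" "j = 0"
  note facts = r1[of "Suc i'" 0] r1[of i' 0] r2[of i' 0] conv_ge(1)[of h "Suc i'" "Suc 0" a b]
    conv_ge(2)[of h "Suc i'" "Suc 0" b a] conv_ge(3)[of h "Suc i'" 0 a b]
    conv_ge(1)[of h i' 0 a b] conv_ge(2)[of h i' 0 b a] ab
  show ?thesis
    unfolding ij
    by (cases rule: conv_0_cases[of a b h "Suc i'"];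
        cases rule: conv_Suc_cases[of a b h i' 0];
        use facts in linarith)
next
  fix j' assume ij: "i = 0" "j = Suc j'"
  note facts = r1[of 0 "Suc j'"] r1[of 0 j'] r3[of 0 j'] conv_ge(1)[of h 0 "Suc (Suc j')" a b]
    conv_ge(2)[of h 0 "Suc (Suc j')" b a] conv_ge(3)[of h 0 "Suc j'" a b] h0[of j']
    h0[of "Suc j'"] h0[of "Suc (Suc j')"] h0[of "Suc (Suc (Suc j'))"] ab
  show ?thesis
    unfolding ij conv_simps(1)
    by (cases rule: conv_Suc_cases[of a b h 0 j']; use facts in linarith)
next
  assume ij: "i = 0" "j = 0"
  note facts = r1[of 0 0] conv_ge(1)[of h 0 "Suc 0" a b] conv_ge(2)[of h 0 "Suc 0" b a]
    conv_ge(3)[of h 0 0 a b] h0[of 0] h0[of "Suc 0"] h0[of "Suc (Suc 0)"]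
    ab
  show ?thesis
    unfolding ij conv_simps(1)
    by (cases rule: conv_0_cases[of a b h 0]; use facts in linarith)
qed

text \<open>Some cases use concavity of \<open>h\<close> in \<open>i\<close>. In positive columns it
  is the sum of the first two rhombi; in column 0 it is the assumption \<open>m\<close>.\<close>

lemma conv_rhombus2:
  shows "conv a b h (Suc (Suc i)) (Suc j) + conv a b h i j
    \<le> conv a b h (Suc i) (Suc j) + conv a b h (Suc i) j"
proof (cases i; cases j)
  fix i' j' assume ij: "i = Suc i'" "j = Suc j'"
  note facts = r1[of "Suc i'" "Suc j'"] r1[of i' "Suc j'"] r1[of i' j'] r1[of "Suc i'" j']
    r2[of "Suc i'" "Suc j'"] r2[of i' "Suc j'"] r2[of i' j'] r2[of "Suc i'" j']
    r3[of "Suc i'" j'] r3[of i' j'] conv_ge(1)[of h "Suc i'" "Suc (Suc j')" a b]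
    conv_ge(2)[of h "Suc i'" "Suc (Suc j')" b a] conv_ge(3)[of h "Suc i'" "Suc j'" a b]
    conv_ge(1)[of h "Suc i'" "Suc j'" a b] conv_ge(2)[of h "Suc i'" "Suc j'" b a]
    conv_ge(3)[of h "Suc i'" j' a b] ab
  show ?thesis
    unfolding ij
    by (cases rule: conv_Suc_cases[of a b h "Suc (Suc i')" "Suc j'"];
        cases rule: conv_Suc_cases[of a b h i' j'];
        use facts in linarith)
next
  fix i' assume ij: "i = Suc i'" "j = 0"
  note facts = r1[of "Suc i'" 0] r1[of i' 0] r2[of "Suc i'" 0] r2[of i' 0] m[of "Suc i'"]
    m[of i'] conv_ge(1)[of h "Suc i'" "Suc 0" a b] conv_ge(2)[of h "Suc i'" "Suc 0" b a]
    conv_ge(3)[of h "Suc i'" 0 a b] conv_ge(1)[of h "Suc i'" 0 a b]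
    conv_ge(2)[of h "Suc i'" 0 b a] ab
  show ?thesis
    unfolding ij
    by (cases rule: conv_Suc_cases[of a b h "Suc (Suc i')" 0];
        cases rule: conv_0_cases[of a b h i'];
        use facts in linarith)
next
  fix j' assume ij: "i = 0" "j = Suc j'"
  note facts = r1[of 0 "Suc j'"] r1[of 0 j'] r2[of 0 "Suc j'"] r2[of 0 j'] r3[of 0 j']
    conv_ge(1)[of h 0 "Suc (Suc j')" a b] conv_ge(2)[of h 0 "Suc (Suc j')" b a]
    conv_ge(3)[of h 0 "Suc j'" a b] conv_ge(1)[of h 0 "Suc j'" a b]
    conv_ge(2)[of h 0 "Suc j'" b a] conv_ge(3)[of h 0 j' a b] h0[of j'] h0[of "Suc j'"]
    h0[of "Suc (Suc j')"] h0[of "Suc (Suc (Suc j'))"] ab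
  show ?thesis
    unfolding ij conv_simps(1)
    by (cases rule: conv_Suc_cases[of a b h "Suc 0" "Suc j'"]; use facts in linarith)
next
  assume ij: "i = 0" "j = 0"
  note facts = r1[of 0 0] r2[of 0 0] m[of 0] conv_ge(1)[of h 0 "Suc 0" a b]
    conv_ge(2)[of h 0 "Suc 0" b a] conv_ge(3)[of h 0 0 a b] conv_ge(1)[of h 0 0 a b]
    conv_ge(2)[of h 0 0 b a] h0[of 0] h0[of "Suc 0"] h0[of "Suc (Suc 0)"]
    ab
  show ?thesis
    unfolding ij conv_simps(1)
    by (cases rule: conv_Suc_cases[of a b h "Suc 0" 0]; use facts in linarith)
qed

text \<open>Here concavity in \<open>j\<close> enters; it is the sum of the first and third
  rhombi.\<close>

lemma conv_rhombus3:
  shows "conv a b h (Suc i) (Suc (Suc j)) + conv a b h i j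
    \<le> conv a b h (Suc i) (Suc j) + conv a b h i (Suc j)"
proof (cases i; cases j)
  fix i' j' assume ij: "i = Suc i'" "j = Suc j'"
  note facts = r1[of "Suc i'" "Suc j'"] r1[of i' "Suc j'"] r1[of i' j'] r1[of "Suc i'" j']
    r1[of i' "Suc (Suc j')"] r2[of i' "Suc (Suc j')"] r2[of i' "Suc j'"] r2[of i' j']
    r3[of "Suc i'" "Suc j'"] r3[of i' "Suc j'"] r3[of "Suc i'" j'] r3[of i' j']
    conv_ge(1)[of h "Suc i'" "Suc (Suc j')" a b] conv_ge(2)[of h "Suc i'" "Suc (Suc j')" b a]
    conv_ge(3)[of h "Suc i'" "Suc j'" a b] conv_ge(1)[of h i' "Suc (Suc j')" a b]
    conv_ge(2)[of h i' "Suc (Suc j')" b a] conv_ge(3)[of h i' "Suc j'" a b]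
    ab
  show ?thesis
    unfolding ij
    by (cases rule: conv_Suc_cases[of a b h "Suc i'" "Suc (Suc j')"];
        cases rule: conv_Suc_cases[of a b h i' j'];
        use facts in linarith)
next
  fix i' assume ij: "i = Suc i'" "j = 0"
  note facts = r1[of "Suc i'" 0] r1[of i' 0] r1[of i' "Suc 0"] r2[of i' "Suc 0"] r2[of i' 0]
    r3[of "Suc i'" 0] r3[of i' 0] conv_ge(1)[of h "Suc i'" "Suc 0" a b]
    conv_ge(2)[of h "Suc i'" "Suc 0" b a] conv_ge(3)[of h "Suc i'" 0 a b]
    conv_ge(1)[of h i' "Suc 0" a b] conv_ge(2)[of h i' "Suc 0" b a] conv_ge(3)[of h i' 0 a b]
    ab
  show ?thesis
    unfolding ij
    by (cases rule: conv_Suc_cases[of a b h "Suc i'" "Suc 0"];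
        cases rule: conv_0_cases[of a b h i'];
        use facts in linarith)
next
  fix j' assume ij: "i = 0" "j = Suc j'"
  note facts = r1[of 0 "Suc j'"] r1[of 0 j'] r3[of 0 "Suc j'"] r3[of 0 j']
    conv_ge(1)[of h 0 "Suc (Suc j')" a b] conv_ge(2)[of h 0 "Suc (Suc j')" b a]
    conv_ge(3)[of h 0 "Suc j'" a b] h0[of j'] h0[of "Suc j'"] h0[of "Suc (Suc j')"]
    h0[of "Suc (Suc (Suc j'))"] ab
  show ?thesis
    unfolding ij conv_simps(1)
    by (cases rule: conv_Suc_cases[of a b h 0 "Suc (Suc j')"]; use facts in linarith)
next
  assume ij: "i = 0" "j = 0"
  note facts = r1[of 0 0] r3[of 0 0] conv_ge(1)[of h 0 "Suc 0" a b]
    conv_ge(2)[of h 0 "Suc 0" b a] conv_ge(3)[of h 0 0 a b] h0[of 0] h0[of "Suc 0"]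
    h0[of "Suc (Suc 0)"] ab
  show ?thesis
    unfolding ij conv_simps(1)
    by (cases rule: conv_Suc_cases[of a b h 0 "Suc 0"]; use facts in linarith)
qed

end

text \<open>
  A concave function is recovered from its convolution with a tropical line: the linear functional
  supporting \<open>h\<close> at \<open>(i, j)\<close> lies in one of the three sectors of the line, which makes the
  corresponding one of the three bounds an equality.
\<close>

lemma conv_recover:
  assumes r1: "\<And>i j. h (Suc i) j + h i (Suc j) \<le> h (Suc i) (Suc j) + h i j"
    and r2: "\<And>i j. h (Suc (Suc i)) (Suc j) + h i j \<le> h (Suc i) (Suc j) + h (Suc i) j"
    and r3: "\<And>i j. h (Suc i) (Suc (Suc j)) + h i j \<le> h (Suc i) (Suc j) + h i (Suc j)"
  shows "h (Suc i) (Suc j) \<le> conv a b h (Suc i) (Suc j)"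
    "h (Suc i) (Suc j) + b \<le> conv a b h (Suc (Suc i)) (Suc j)"
    "h (Suc i) (Suc j) + a \<le> conv a b h (Suc (Suc i)) (Suc (Suc j))"
    "h (Suc i) (Suc j) = conv a b h (Suc i) (Suc j) \<or>
     h (Suc i) (Suc j) + b = conv a b h (Suc (Suc i)) (Suc j) \<or>
     h (Suc i) (Suc j) + a = conv a b h (Suc (Suc i)) (Suc (Suc j))"
proof -
  show le: "h (Suc i) (Suc j) \<le> conv a b h (Suc i) (Suc j)"
    "h (Suc i) (Suc j) + b \<le> conv a b h (Suc (Suc i)) (Suc j)"
    "h (Suc i) (Suc j) + a \<le> conv a b h (Suc (Suc i)) (Suc (Suc j))"
    unfolding conv_simps by simp_all
  show "h (Suc i) (Suc j) = conv a b h (Suc i) (Suc j) \<or>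
     h (Suc i) (Suc j) + b = conv a b h (Suc (Suc i)) (Suc j) \<or>
     h (Suc i) (Suc j) + a = conv a b h (Suc (Suc i)) (Suc (Suc j))"
  proof (rule ccontr)
    assume "\<not> ?thesis"
    then have "h (Suc i) (Suc j) < conv a b h (Suc i) (Suc j)"
      "h (Suc i) (Suc j) + b < conv a b h (Suc (Suc i)) (Suc j)"
      "h (Suc i) (Suc j) + a < conv a b h (Suc (Suc i)) (Suc (Suc j))"
      using le by linarith+
    then have "h (Suc i) (Suc j) < h i (Suc j) + b \<or> h (Suc i) (Suc j) < h i j + a"
      "h (Suc i) (Suc j) + b < h (Suc (Suc i)) (Suc j) \<or> h (Suc i) (Suc j) + b < h (Suc i) j + a"
      "h (Suc i) (Suc j) + a < h (Suc (Suc i)) (Suc (Suc j)) \<or>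
       h (Suc i) (Suc j) + a < h (Suc i) (Suc (Suc j)) + b"
      unfolding conv_simps by linarith+
    \<comment> \<open>The shifts cancel. Among the six neighbours of \<open>(Suc i, Suc j)\<close>,
      the chosen ones include two opposite ones or are three alternate ones, and their excess
      contradicts concavity.\<close>
    then show False
      using r1[of i j] r1[of "Suc i" j] r1[of i "Suc j"] r1[of "Suc i" "Suc j"]
        r2[of i j] r2[of i "Suc j"] r3[of i j] r3[of "Suc i" j] by linarith
  qed
qed

lemma conv_hive:
  assumes h: "h \<in> hives l m v" and l: "is_partition l" and m: "is_partition m" and v: "is_partition v"
    and ab: "b \<le> a"
  shows "conv a b h \<in> hives (insert_part l a) (insert_part m b) (insert_part v (a - b))"
proof -
  have base: "h 0 j = 0" "h i 0 = sum m {..<i}" for i j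
    using h by (simp_all add: hives_def)
  have r: "h (Suc i) j + h i (Suc j) \<le> h (Suc i) (Suc j) + h i j"
    "h (Suc (Suc i)) (Suc j) + h i j \<le> h (Suc i) (Suc j) + h (Suc i) j"
    "h (Suc i) (Suc (Suc j)) + h i j \<le> h (Suc i) (Suc j) + h i (Suc j)" for i j
    using h by (simp_all add: hives_def)
  have concave: "h (Suc (Suc i)) 0 + h i 0 \<le> h (Suc i) 0 + h (Suc i) 0" for i
    using partition_le[OF m, of i "Suc i"] by (simp add: base)
  have left: "conv a b h i 0 = sum (insert_part m b) {..<i}" for i
    by (cases i) (simp_all add: conv_simps base sum_insert_part[OF m] del: sum.lessThan_Suc)
  have l_ev: "\<forall>\<^sub>F j in sequentially. h i j = sum l {..<i}" for i
    using h by (simp add: hives_def)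
  have right: "\<forall>\<^sub>F j in sequentially. conv a b h i j = sum (insert_part l a) {..<i}" for i
  proof (cases i)
    case (Suc i')
    have "\<forall>\<^sub>F j in sequentially. conv a b h i (Suc j) = sum (insert_part l a) {..<i}"
      using l_ev[of i'] iffD2[OF eventually_sequentially_Suc l_ev[of i']]
        iffD2[OF eventually_sequentially_Suc l_ev[of i]]
    proof eventually_elim
      \<comment> \<open>At \<open>Suc j\<close> the third term is present, and its \<open>a\<close>
        dominates the \<open>b\<close> of the second.\<close>
      case (elim j)
      then show ?case unfolding Suc conv_simps sum_insert_part[OF l] using ab by simp
    qed
    then show ?thesis by (rule iffD1[OF eventually_sequentially_Suc])
  qed (simp add: conv_simps)
  have v_ev: "\<forall>\<^sub>F i in sequentially. h i j = sum m {..<i} + sum v {..<j}" for j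
    using h by (simp add: hives_def)
  have mz: "\<forall>\<^sub>F i in sequentially. m i = 0"
    using nonzero_iff_less_num_parts[OF m] unfolding eventually_sequentially
    by (meson not_less)
  have below: "\<forall>\<^sub>F i in sequentially.
      conv a b h i j = sum (insert_part m b) {..<i} + sum (insert_part v (a - b)) {..<j}" for j
  proof (cases j)
    case 0
    then show ?thesis by (simp add: left)
  next
    case (Suc j')
    have "\<forall>\<^sub>F i in sequentially. conv a b h (Suc i) j
        = sum (insert_part m b) {..<Suc i} + sum (insert_part v (a - b)) {..<j}"
      using v_ev[of j'] v_ev[of j] iffD2[OF eventually_sequentially_Suc v_ev[of j]] mz
    proof eventually_elim
      \<comment> \<open>As \<open>m i\<close> is 0, the second term absorbs the first; the other two
        are the maximum for \<open>v\<close>, raised by \<open>b\<close> and the sum of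
        \<open>m\<close>.\<close>
      case (elim i)
      then show ?case unfolding Suc conv_simps sum_insert_part[OF m] sum_insert_part[OF v]
        using ab by simp
    qed
    then show ?thesis by (rule iffD1[OF eventually_sequentially_Suc])
  qed
  show ?thesis
    using left right below conv_rhombus1[of h, OF base(1) concave r ab]
      conv_rhombus2[of h, OF base(1) concave r ab] conv_rhombus3[of h, OF base(1) concave r ab]
    unfolding hives_def by (simp add: conv_simps)
qed

text \<open>By \<open>conv_recover\<close> an inner value of \<open>h\<close> is the minimum of
  three values of its convolution, two of them lowered by \<open>b\<close> and \<open>a\<close>; row
  0 and column 0 are prescribed by \<open>hives\<close>.\<close>

lemma inj_on_conv: "inj_on (conv a b) (hives l m v)"
proof (rule inj_onI, intro ext)
  fix h h' i j assume h: "h \<in> hives l m v" and h': "h' \<in> hives l m v"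
    and eq: "conv a b h = conv a b h'"
  have "h (Suc i) (Suc j) = h' (Suc i) (Suc j)" for i j
  proof -
    have "h (Suc i) j + h i (Suc j) \<le> h (Suc i) (Suc j) + h i j"
      "h (Suc (Suc i)) (Suc j) + h i j \<le> h (Suc i) (Suc j) + h (Suc i) j"
      "h (Suc i) (Suc (Suc j)) + h i j \<le> h (Suc i) (Suc j) + h i (Suc j)" for i j
      using h by (simp_all add: hives_def)
    note 1 = conv_recover[of h, OF this, where i = i and j = j and a = a and b = b]
    have "h' (Suc i) j + h' i (Suc j) \<le> h' (Suc i) (Suc j) + h' i j"
      "h' (Suc (Suc i)) (Suc j) + h' i j \<le> h' (Suc i) (Suc j) + h' (Suc i) j"
      "h' (Suc i) (Suc (Suc j)) + h' i j \<le> h' (Suc i) (Suc j) + h' i (Suc j)" for i j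
      using h' by (simp_all add: hives_def)
    note 2 = conv_recover[of h', OF this, where i = i and j = j and a = a and b = b]
    show ?thesis using 1 2 unfolding eq by linarith
  qed
  then show "h i j = h' i j"
    using h h' by (cases i; cases j) (simp_all add: hives_def)
qed

theorem theorem3p1:
  fixes l m v :: "nat \<Rightarrow> nat" and a b :: nat
  assumes "is_partition l" and "is_partition m" and "is_partition v"
    and "b \<le> a"
  shows "LR_coeff l m v \<le> LR_coeff (add_column l a) (add_column m b) (add_column v (a - b)) \<and>
         LR_coeff l m v \<le> LR_coeff (insert_part l a) (insert_part m b) (insert_part v (a - b))"
proof (cases "\<forall>i. m i \<le> l i")
  case True
  then have ml: "m i \<le> l i" for i by blast
  have "add_column m b i \<le> add_column l a i" for i
    using ml[of i] assms(4) by (simp add: add_column_def)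
  moreover have "inj_on (\<lambda>h i j. h i j + min i (min a (b + j))) (hives l m v)"
    by (rule inj_onI) (simp add: fun_eq_iff)
  ultimately have "LR_coeff l m v \<le> LR_coeff (add_column l a) (add_column m b) (add_column v (a - b))"
    using add_column_hive[OF _ assms(4)]
    by (intro LR_coeff_mono assms ml is_partition_add_column) auto
  moreover have
    "LR_coeff l m v \<le> LR_coeff (insert_part l a) (insert_part m b) (insert_part v (a - b))"
    using conv_hive[OF _ assms(1-4)] insert_part_mono[OF assms(2,1) ml assms(4)] inj_on_conv
    by (intro LR_coeff_mono[where f = "conv a b"] assms ml is_partition_insert_part) auto
  ultimately show ?thesis by blast
next
  case False
  then have "\<not> diagram m \<subseteq> diagram l" unfolding diagram_subset_iff .
  then show ?thesis by (simp add: LR_coeff_def)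
qed

end
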